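(* Let $\mathcal{A}=\{a_1,\dots,a_n\}\subset\mathbb{R}^d$ and $C\in\mathbb{R}^{d\times n}$. Assume that $A$, $C$ and $\bar C$ are uniform, where $A\in\mathbb{R}^{(d+1)\times n}$ is the matrix with columns $(1,a_1),\dots,(1,a_n)$ and $\bar C\in\mathbb{R}^{(d+1)\times n}$ is obtained from $C$ by adding a first row of ones. Suppose $\mathbf{0}\in\mathcal{C}^\circ$ and that there exists $I\subset\{1,\dots,n\}$ such that $A$ and $C$ are $I$-compatible. Then $n_{\mathcal{A}}(C)>0$.
   Context: Setting: $d\ge1$, $n\ge d+2$, and $a_1,\dots,a_n$ are distinct points of $\mathbb{R}^d$. For $C=(c_{ij})\in\mathbb{R}^{d\times n}$, $n_{\mathcal{A}}(C)$ is the (possibly infinite) number of solutions $x\in\mathbb{R}_{>0}^d$ of the system $\sum_{j=1}^n c_{ij}x^{a_j}=0$, $i=1,\dots,d$ (real exponents, $x^{a}=\prod_l x_l^{a_{l}}$). $\mathcal{C}^\circ=\mathbb{R}_{>0}C_1+\dots+\mathbb{R}_{>0}C_n$, where $C_1,\dots,C_n\in\mathbb{R}^d$ are the columns of $C$. A matrix is uniform if all its maximal minors are nonzero. For $M\in\mathbb{R}^{r\times s}$ of rank $r$, a Gale dual matrix of $M$ is any $N\in\mathbb{R}^{s\times(s-r)}$ whose columns form a basis of $\ker M$ (it is the empty matrix if $s=r$). A real matrix is mixed if every column contains a strictly positive and a strictly negative entry; it is dominating if it contains no (nonempty) square mixed submatrix; mixed dominating means mixed and dominating. The empty matrix is considered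 mixed and dominating. Let $\mathscr{C}=\{C_1,\dots,C_n\}$. For $J\subset\{1,\dots,n\}$ put $\mathcal{A}_J=\{a_j:j\in J\}$, $\mathscr{C}_J=\{C_j:j\in J\}$, and let $A_J$, $\bar C_J$ be the submatrices of $A$, $\bar C$ formed by the columns with index in $J$. $\operatorname{chull}$ denotes convex hull. $A$ and $C$ are called $I$-compatible if: (1) $A_I$ and $\bar C_I$ admit Gale dual matrices which are mixed dominating and have the same sign pattern; (2) $\operatorname{chull}(\mathcal{A}_I)=\operatorname{chull}(\mathcal{A})$ and $\operatorname{chull}(\mathscr{C}_I)=\operatorname{chull}(\mathscr{C})$; (3) for each $j\notin I$ there exists $J\subset I$ with $|J|=d+1$ such that $a_j\in\operatorname{chull}(\mathcal{A}_J)$ and $C_j\in\operatorname{chull}(\mathscr{C}_J)$. *)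

theory Defs
  imports "HOL-Analysis.Analysis" "HOL-Library.Extended_Nat"
begin

(* Meant for matrices with at most as many rows as columns.  A maximal minor is given by an
   injective choice s of columns; the order in which they are listed only changes its sign. *)
definition uniform :: "real^'n^'m \<Rightarrow> bool" where
  "uniform M \<longleftrightarrow> (\<forall>s :: 'm \<Rightarrow> 'n. inj s \<longrightarrow> det (\<chi> i k. M $ i $ s k) \<noteq> 0)"

(* The extra first row is indexed by None. *)
definition add_ones_row :: "real^'n^'d \<Rightarrow> real^'n^('d option)" where
  "add_ones_row M = (\<chi> i j. case i of None \<Rightarrow> 1 | Some l \<Rightarrow> M $ l $ j)"

definition point_matrix :: "('n \<Rightarrow> real^'d) \<Rightarrow> real^'n^('d option)" where
  "point_matrix a = add_ones_row (\<chi> l j. a j $ l)"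

definition monomial_at :: "real^'d \<Rightarrow> real^'d \<Rightarrow> real" where
  "monomial_at x b = (\<Prod>l\<in>UNIV. x $ l powr b $ l)"

definition positive_solutions :: "('n \<Rightarrow> real^'d) \<Rightarrow> real^'n^'d \<Rightarrow> (real^'d) set" where
  "positive_solutions a C =
     {x. (\<forall>l. x $ l > 0) \<and> (\<forall>i. (\<Sum>j\<in>UNIV. C $ i $ j * monomial_at x (a j)) = 0)}"

definition num_positive_solutions :: "('n \<Rightarrow> real^'d) \<Rightarrow> real^'n^'d \<Rightarrow> enat" where
  "num_positive_solutions a C =
     (if finite (positive_solutions a C) then enat (card (positive_solutions a C)) else \<infinity>)"

definition open_column_cone :: "real^'n^'d \<Rightarrow> (real^'d) set" where
  "open_column_cone C =
     {\<Sum>j\<in>UNIV. u j *\<^sub>R column j C | u :: 'n \<Rightarrow> real. \<forall>j. u j > 0}"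

(* A matrix with row set R and column set S is a function of two indices of which only the
   values on R and S matter; a matrix without columns is mixed. *)
definition mixed :: "'r set \<Rightarrow> 's set \<Rightarrow> ('r \<Rightarrow> 's \<Rightarrow> real) \<Rightarrow> bool" where
  "mixed R S N \<longleftrightarrow> (\<forall>k\<in>S. (\<exists>i\<in>R. N i k > 0) \<and> (\<exists>i\<in>R. N i k < 0))"

definition dominating :: "'r set \<Rightarrow> 's set \<Rightarrow> ('r \<Rightarrow> 's \<Rightarrow> real) \<Rightarrow> bool" where
  "dominating R S N \<longleftrightarrow>
     (\<forall>R' S'. R' \<subseteq> R \<and> S' \<subseteq> S \<and> finite R' \<and> finite S' \<and> R' \<noteq> {} \<and> card R' = card S'
        \<longrightarrow> \<not> mixed R' S' N)"

definition mixed_dominating :: "'r set \<Rightarrow> 's set \<Rightarrow> ('r \<Rightarrow> 's \<Rightarrow> real) \<Rightarrow> bool" where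
  "mixed_dominating R S N \<longleftrightarrow> mixed R S N \<and> dominating R S N"

definition same_sign_pattern ::
    "'r set \<Rightarrow> 's set \<Rightarrow> ('r \<Rightarrow> 's \<Rightarrow> real) \<Rightarrow> ('r \<Rightarrow> 's \<Rightarrow> real) \<Rightarrow> bool" where
  "same_sign_pattern R S N N' \<longleftrightarrow> (\<forall>i\<in>R. \<forall>k\<in>S. sgn (N i k) = sgn (N' i k))"

(* For a submatrix M_J of the columns of M with index in J, the space R^J is identified with
   the vectors of real^'n that vanish outside J. *)
definition kernel_on :: "'n set \<Rightarrow> real^'n^'m \<Rightarrow> (real^'n) set" where
  "kernel_on J M = {v. (\<forall>j. j \<notin> J \<longrightarrow> v $ j = 0) \<and> M *v v = 0}"

definition column_on :: "'n set \<Rightarrow> ('n \<Rightarrow> nat \<Rightarrow> real) \<Rightarrow> nat \<Rightarrow> real^'n" where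
  "column_on J N k = (\<chi> j. if j \<in> J then N j k else 0)"

(* The column index set of a Gale dual matrix of M_J. *)
definition gale_cols :: "'n set \<Rightarrow> real^'n^'m \<Rightarrow> nat set" where
  "gale_cols J M = {..< card J - CARD('m)}"

(* N, with rows J and columns gale_cols J M, is a Gale dual matrix of M_J, where M_J is
   required to have full row rank. *)
definition gale_dual_on :: "'n set \<Rightarrow> real^'n^'m \<Rightarrow> ('n \<Rightarrow> nat \<Rightarrow> real) \<Rightarrow> bool" where
  "gale_dual_on J M N \<longleftrightarrow>
     dim ((\<lambda>j. column j M) ` J) = CARD('m) \<and>
     inj_on (column_on J N) (gale_cols J M) \<and>
     independent (column_on J N ` gale_cols J M) \<and>
     span (column_on J N ` gale_cols J M) = kernel_on J M"

definition compatible :: "'n set \<Rightarrow> ('n \<Rightarrow> real^'d) \<Rightarrow> real^'n^'d \<Rightarrow> bool" where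
  "compatible I a C \<longleftrightarrow>
     (\<exists>N N'. gale_dual_on I (point_matrix a) N \<and> gale_dual_on I (add_ones_row C) N' \<and>
        mixed_dominating I (gale_cols I (point_matrix a)) N \<and>
        mixed_dominating I (gale_cols I (add_ones_row C)) N' \<and>
        same_sign_pattern I (gale_cols I (point_matrix a)) N N') \<and>
     convex hull (a ` I) = convex hull (range a) \<and>
     convex hull ((\<lambda>j. column j C) ` I) = convex hull (range (\<lambda>j. column j C)) \<and>
     (\<forall>j. j \<notin> I \<longrightarrow>
        (\<exists>J\<subseteq>I. card J = CARD('d) + 1 \<and> a j \<in> convex hull (a ` J) \<and>
           column j C \<in> convex hull ((\<lambda>j. column j C) ` J)))"

end

theory Submission
  imports Defs
begin

text \<open>
  With \<open>x = exp t\<close> the system reads \<open>F t = 0\<close>, where \<open>F t\<close> is the average of the columns of \<open>C\<close> with weights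
  proportional to \<open>exp (a j \<bullet> t)\<close>. For dominating Gale duals the sign pattern alone decides which index
  sets are complements of faces, so the convex hulls of the \<open>a j\<close> and of the columns have the same faces,
  and by uniformity these are simplices. If \<open>F\<close> had no zero, retract \<open>F t\<close> radially from \<open>0\<close> to the
  boundary of the hull of the columns, transport it by barycentric coordinates to the boundary of the hull
  of the \<open>a j\<close>, and let \<open>V\<close> be the vector from the centroid \<open>p0\<close> to that point. Brouwer's theorem gives
  \<open>t = - k V\<close> for every \<open>k\<close>. As \<open>k\<close> grows, the weights concentrate on the face of the \<open>a j\<close> maximised in
  direction \<open>t\<close>, so that \<open>V \<bullet> t > 0\<close> in the limit, which contradicts \<open>t = - k V\<close>.
\<close>

section \<open>Dominating matrices\<close>

lemma exists_pos_summand: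
  fixes f :: "'a \<Rightarrow> real"
  assumes "finite A" "sum f A \<ge> 0" "k \<in> A" "f k < 0"
  obtains l where "l \<in> A" "f l > 0"
proof -
  have "\<exists>l\<in>A. f l > 0"
  proof (rule ccontr)
    assume "\<not> ?thesis"
    then have "sum f A < sum (\<lambda>_. 0) A"
      using assms by (intro sum_strict_mono_ex1) (auto simp: not_less)
    with assms show False by simp
  qed
  with that show thesis by blast
qed

text \<open>After scaling column \<open>k\<close> by \<open>y k\<close>, each contributing column
  has a negative entry in some row of \<open>T\<close>, and a row with nonnegative sum and a
  negative entry also has a positive one. Alternating these choices closes up in a cycle, which
  yields a forbidden square mixed submatrix.\<close>

lemma dominating_no_semipositive_combination:
  fixes N :: "'r \<Rightarrow> 's \<Rightarrow> real"
  assumes dom: "dominating R S N" and "T \<subseteq> R" "finite S"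
    and cols: "\<And>k. k \<in> S \<Longrightarrow> (\<forall>i\<in>T. N i k = 0) \<or> ((\<exists>i\<in>T. N i k > 0) \<and> (\<exists>i\<in>T. N i k < 0))"
    and nonneg: "\<And>i. i \<in> T \<Longrightarrow> (\<Sum>k\<in>S. N i k * y k) \<ge> 0"
    and "i \<in> T"
  shows "(\<Sum>k\<in>S. N i k * y k) = 0"
proof (rule ccontr)
  assume nz: "(\<Sum>k\<in>S. N i k * y k) \<noteq> 0"
  define S' where "S' = {k\<in>S. y k \<noteq> 0 \<and> (\<exists>i\<in>T. N i k \<noteq> 0)}"
  have "\<exists>k\<in>S. N i k * y k \<noteq> 0"
    using nz by (meson sum.neutral)
  then have "S' \<noteq> {}"
    using \<open>i \<in> T\<close> unfolding S'_def by auto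
  have "finite S'"
    using \<open>finite S\<close> unfolding S'_def by auto
  have "\<exists>i\<in>T. N i k * y k < 0" if "k \<in> S'" for k
  proof -
    from that cols have "\<exists>i\<in>T. N i k > 0" "\<exists>i\<in>T. N i k < 0" "y k \<noteq> 0"
      unfolding S'_def by auto
    then show ?thesis
      by (metis linorder_less_linear mult_less_0_iff)
  qed
  then obtain f where f: "\<And>k. k \<in> S' \<Longrightarrow> f k \<in> T \<and> N (f k) k * y k < 0"
    by metis
  have "\<exists>k'\<in>S'. N i k' * y k' > 0" if "i \<in> f ` S'" for i
  proof -
    from that obtain k where k: "k \<in> S'" "i = f k" by blast
    then have "k \<in> S" "i \<in> T" "N i k * y k < 0"
      using f unfolding S'_def by auto
    from exists_pos_summand[OF \<open>finite S\<close> nonneg[OF \<open>i \<in> T\<close>] this(1,3)]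
    obtain l where "l \<in> S" "N i l * y l > 0" by blast
    moreover from this have "N i l \<noteq> 0" "y l \<noteq> 0" by auto
    ultimately have "l \<in> S'"
      using \<open>i \<in> T\<close> unfolding S'_def by blast
    with \<open>N i l * y l > 0\<close> show ?thesis by blast
  qed
  then obtain g where g: "\<And>i. i \<in> f ` S' \<Longrightarrow> g i \<in> S' \<and> N i (g i) * y (g i) > 0"
    by metis
  \<comment> \<open>A minimal invariant set of columns is a cycle of \<open>g \<circ> f\<close>; with the rows \<open>f ` K\<close> it is a square mixed submatrix.\<close>
  have "\<exists>K. K \<subseteq> S' \<and> K \<noteq> {} \<and> (g \<circ> f) ` K \<subseteq> K"
    using \<open>S' \<noteq> {}\<close> g by (intro exI[of _ S']) auto
  then obtain K where K: "K \<subseteq> S'" "K \<noteq> {}" "(g \<circ> f) ` K \<subseteq> K"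
    and min: "\<And>K'. \<lbrakk>K' \<subseteq> S'; K' \<noteq> {}; (g \<circ> f) ` K' \<subseteq> K'\<rbrakk> \<Longrightarrow> card K \<le> card K'"
    using ex_has_least_nat[of "\<lambda>K. K \<subseteq> S' \<and> K \<noteq> {} \<and> (g \<circ> f) ` K \<subseteq> K" _ card] by metis
  have "finite K"
    using K \<open>finite S'\<close> finite_subset by blast
  have "card K \<le> card ((g \<circ> f) ` K)"
    by (rule min) (use K in blast)+
  then have gfK: "(g \<circ> f) ` K = K"
    using K \<open>finite K\<close> by (simp add: card_seteq)
  then have "inj_on (g \<circ> f) K"
    using \<open>finite K\<close> by (simp add: eq_card_imp_inj_on)
  \<comment> \<open>Injectivity of \<open>g \<circ> f\<close> on \<open>K\<close> passes to
    \<open>f\<close>, so the chosen rows are as many as the columns.\<close>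
  then have "card (f ` K) = card K"
    by (simp add: card_image inj_on_imageI2)
  moreover have "mixed (f ` K) K N"
    unfolding mixed_def
  proof
    fix k assume "k \<in> K"
    with gfK obtain k' where k': "k' \<in> K" "k = g (f k')" by auto
    \<comment> \<open>Both products share the factor \<open>y k\<close>, so the two entries have
      opposite signs whatever the sign of \<open>y k\<close>.\<close>
    have "N (f k) k * y k < 0" "N (f k') k * y k > 0"
      using f g K \<open>k \<in> K\<close> k' by auto
    moreover have "f k \<in> f ` K" "f k' \<in> f ` K"
      using \<open>k \<in> K\<close> k' by auto
    ultimately show "(\<exists>i\<in>f ` K. N i k > 0) \<and> (\<exists>i\<in>f ` K. N i k < 0)"
      unfolding mult_less_0_iff zero_less_mult_iff by fastforce
  qed
  moreover have "f ` K \<subseteq> R" "K \<subseteq> S"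
    using f K \<open>T \<subseteq> R\<close> unfolding S'_def by blast+
  ultimately show False
    using dom \<open>finite K\<close> \<open>K \<noteq> {}\<close> unfolding dominating_def by blast
qed

section \<open>Linear algebra\<close>

text \<open>This is Stiemke's lemma. The projection of \<open>L\<close> to the coordinates in
  \<open>T\<close> misses the simplex spanned by the unit vectors of \<open>T\<close>; a strictly
  separating functional vanishes on the subspace and is positive on these unit vectors.\<close>

lemma positive_functional_exists:
  fixes L :: "(real^'n) set"
  assumes L: "subspace L"
    and none: "\<And>x. \<lbrakk>x \<in> L; \<forall>i\<in>T. x $ i \<ge> 0\<rbrakk> \<Longrightarrow> \<forall>i\<in>T. x $ i = 0"
  obtains p :: "real^'n" where "\<forall>i\<in>T. p $ i > 0" "\<forall>i. i \<notin> T \<longrightarrow> p $ i = 0" "\<forall>x\<in>L. p \<bullet> x = 0"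
proof (cases "T = {}")
  case True
  then show thesis by (intro that[of 0]) auto
next
  case False
  define r :: "real^'n \<Rightarrow> real^'n" where "r x = (\<chi> i. if i \<in> T then x $ i else 0)" for x
  define D where "D = convex hull ((\<lambda>i. axis i (1::real)) ` T)"
  have "linear r"
    by (rule linearI) (auto simp: r_def vec_eq_iff)
  then have rL: "subspace (r ` L)"
    using L by (rule linear_subspace_image)
  have "convex {x :: real^'n. (\<forall>i. 0 \<le> x $ i) \<and> (\<Sum>i\<in>T. x $ i) = 1}"
    unfolding convex_def
    by (auto simp: sum.distrib simp flip: sum_distrib_left)
  moreover have "(\<lambda>i. axis i 1) ` T \<subseteq> {x :: real^'n. (\<forall>i. 0 \<le> x $ i) \<and> (\<Sum>i\<in>T. x $ i) = 1}"
    by (auto simp: axis_def)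
  ultimately have D: "D \<subseteq> {x. (\<forall>i. 0 \<le> x $ i) \<and> (\<Sum>i\<in>T. x $ i) = 1}"
    unfolding D_def by (rule hull_minimal[rotated])
  have "r ` L \<inter> D = {}"
  proof (rule ccontr)
    assume "r ` L \<inter> D \<noteq> {}"
    then obtain x where x: "x \<in> L" "r x \<in> D" by blast
    then have r: "\<forall>i. 0 \<le> r x $ i" "(\<Sum>i\<in>T. r x $ i) = 1"
      using D by auto
    have "x $ i \<ge> 0" if "i \<in> T" for i
      using r(1)[rule_format, of i] that by (simp add: r_def)
    with none[OF x(1)] have "\<forall>i\<in>T. x $ i = 0"
      by simp
    with r(2) show False
      by (simp add: r_def)
  qed
  moreover have "compact D" "convex D" "D \<noteq> {}"
    unfolding D_def using False by (simp_all add: finite_imp_compact_convex_hull)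
  ultimately obtain q b where q: "\<forall>x\<in>r ` L. q \<bullet> x < b" "\<forall>x\<in>D. q \<bullet> x > b"
    using separating_hyperplane_closed_compact[of "r ` L" D] rL
    by (metis subspace_imp_convex closed_subspace)
  \<comment> \<open>A linear functional bounded above on a subspace vanishes there: otherwise some
    multiple of \<open>x\<close> attains the strict bound \<open>b\<close>.\<close>
  have qL: "q \<bullet> x = 0" if "x \<in> r ` L" for x
  proof (rule ccontr)
    assume nz: "q \<bullet> x \<noteq> 0"
    have "(b / (q \<bullet> x)) *\<^sub>R x \<in> r ` L"
      using rL that by (simp add: subspace_scale)
    with q(1) have "q \<bullet> ((b / (q \<bullet> x)) *\<^sub>R x) < b" by blast
    with nz show False by simp
  qed
  have "b > 0"
    using q(1) rL subspace_0 by fastforce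
  show thesis
  proof (rule that[of "r q"]; intro allI ballI impI)
    fix i assume "i \<in> T"
    then have "axis i 1 \<in> D"
      unfolding D_def by (simp add: hull_inc)
    with q(2) \<open>b > 0\<close> have "q \<bullet> axis i 1 > 0" by force
    with \<open>i \<in> T\<close> show "r q $ i > 0"
      by (simp add: r_def inner_axis)
  next
    fix i assume "i \<notin> T" then show "r q $ i = 0" by (simp add: r_def)
  next
    fix x assume "x \<in> L"
    \<comment> \<open>The coordinate projection \<open>r\<close> is self-adjoint.\<close>
    have "r q \<bullet> x = q \<bullet> r x"
      by (auto simp: inner_vec_def r_def intro!: sum.cong)
    with qL \<open>x \<in> L\<close> show "r q \<bullet> x = 0" by simp
  qed
qed

text \<open>\<open>W\<close> is the row space of \<open>M\<close> with free entries outside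
  \<open>I\<close>. A vector orthogonal to \<open>W\<close> vanishes outside \<open>I\<close> and is
  annihilated by the rows of \<open>M\<close>, hence lies in \<open>kernel_on I M\<close>. So
  \<open>p\<close> lies in the double orthogonal complement of \<open>W\<close>, which is
  \<open>W\<close>.\<close>

lemma row_combination_of_orthogonal_kernel_on:
  fixes M :: "real^'n^'m"
  assumes "\<And>x. x \<in> kernel_on I M \<Longrightarrow> p \<bullet> x = 0"
  obtains c where "\<forall>i\<in>I. p $ i = c \<bullet> column i M"
proof -
  define W where "W = {x :: real^'n. \<exists>c. \<forall>i\<in>I. x $ i = c \<bullet> column i M}"
  have "subspace W"
    unfolding subspace_def
  proof (intro conjI ballI allI)
    show "0 \<in> W"
      unfolding W_def by (auto intro: exI[of _ 0])
  next
    fix x y assume "x \<in> W" "y \<in> W"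
    then obtain c d where "\<forall>i\<in>I. x $ i = c \<bullet> column i M" "\<forall>i\<in>I. y $ i = d \<bullet> column i M"
      unfolding W_def by blast
    then show "x + y \<in> W"
      unfolding W_def by (auto intro!: exI[of _ "c + d"] simp: inner_add_left)
  next
    fix s x assume "x \<in> W"
    then obtain c where "\<forall>i\<in>I. x $ i = c \<bullet> column i M"
      unfolding W_def by blast
    then show "s *\<^sub>R x \<in> W"
      unfolding W_def by (auto intro!: exI[of _ "s *\<^sub>R c"])
  qed
  have "x \<in> kernel_on I M" if x: "\<And>w. w \<in> W \<Longrightarrow> w \<bullet> x = 0" for x
  proof -
    have "x $ j = 0" if "j \<notin> I" for j
    proof -
      have "axis j 1 \<in> W"
        unfolding W_def using that by (auto intro!: exI[of _ 0] simp: axis_def)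
      from x[OF this] show ?thesis by (simp add: inner_axis')
    qed
    moreover have "(M *v x) $ l = 0" for l
    proof -
      have "row l M \<in> W"
        unfolding W_def by (auto intro!: exI[of _ "axis l 1"] simp: inner_axis' row_def column_def)
      from x[OF this] show ?thesis
        by (simp add: inner_vec_def matrix_vector_mult_def row_def)
    qed
    ultimately show ?thesis
      unfolding kernel_on_def by (simp add: vec_eq_iff)
  qed
  then have "p \<in> W\<^sup>\<bottom>\<^sup>\<bottom>"
    using assms unfolding orthogonal_comp_def orthogonal_def by (auto simp: inner_commute)
  then have "p \<in> W"
    using \<open>subspace W\<close> by (simp add: orthogonal_comp_self)
  then show thesis
    using that unfolding W_def by blast
qed

section \<open>Points in general position\<close>

lemma sum_option_UNIV:
  fixes f :: "'d::finite option \<Rightarrow> 'b::comm_monoid_add"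
  shows "(\<Sum>i\<in>UNIV. f i) = f None + (\<Sum>l\<in>UNIV. f (Some l))"
  by (simp add: UNIV_option_conv sum.reindex)

text \<open>Both matrices of the theorem thus come from point configurations, which can exchange
  their roles.\<close>

lemma add_ones_row_column: "add_ones_row C = point_matrix (\<lambda>j. column j C)"
  by (simp add: point_matrix_def column_def)

lemma point_matrix_kernel_iff:
  fixes b :: "'n::finite \<Rightarrow> real^'d::finite"
  shows "point_matrix b *v x = 0 \<longleftrightarrow> (\<Sum>j\<in>UNIV. x $ j) = 0 \<and> (\<Sum>j\<in>UNIV. x $ j *\<^sub>R b j) = 0"
proof -
  have "point_matrix b *v x = 0 \<longleftrightarrow>
      (\<Sum>j\<in>UNIV. x $ j) = 0 \<and> (\<forall>l. (\<Sum>j\<in>UNIV. b j $ l * x $ j) = 0)"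
    unfolding vec_eq_iff split_option_all
    by (simp add: point_matrix_def add_ones_row_def matrix_vector_mult_def)
  then show ?thesis
    by (simp add: vec_eq_iff mult.commute)
qed

text \<open>Row combinations of \<open>point_matrix b\<close> are in this way the values of affine
  functions at the points.\<close>

lemma point_matrix_column_inner:
  fixes b :: "'n::finite \<Rightarrow> real^'d::finite"
  shows "c \<bullet> column j (point_matrix b) = c $ None + (\<chi> l. c $ Some l) \<bullet> b j"
  by (simp add: inner_vec_def sum_option_UNIV column_def point_matrix_def add_ones_row_def)

text \<open>If \<open>CARD('d) + 1\<close> points lay on one hyperplane, the nonzero vector with
  entries \<open>- m\<close> and \<open>u\<close> would be in the kernel of the transpose of a
  maximal square submatrix.\<close>

lemma uniform_hyperplane_card:
  fixes b :: "'n::finite \<Rightarrow> real^'d::finite"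
  assumes unif: "uniform (point_matrix b)" and "u \<noteq> 0"
  shows "card {j. b j \<bullet> u = m} \<le> CARD('d)"
proof (rule ccontr)
  assume "\<not> ?thesis"
  then have "CARD('d option) \<le> card {j. b j \<bullet> u = m}"
    by simp
  then obtain s :: "'d option \<Rightarrow> 'n" where s: "range s \<subseteq> {j. b j \<bullet> u = m}" "inj s"
    using card_le_inj[of "UNIV :: 'd option set" "{j. b j \<bullet> u = m}"] by auto
  define B where "B = (\<chi> i k. point_matrix b $ i $ s k)"
  define y where "y = (\<chi> i. case i of None \<Rightarrow> - m | Some l \<Rightarrow> u $ l)"
  have "det (transpose B) \<noteq> 0"
    using unif s unfolding uniform_def B_def by simp
  then have "invertible (transpose B)"
    by (simp add: invertible_det_nz)
  moreover have "transpose B *v y = 0"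
  proof -
    have "(transpose B *v y) $ k = 0" for k
    proof -
      have "(transpose B *v y) $ k = - m + (\<Sum>l\<in>UNIV. b (s k) $ l * u $ l)"
        by (simp add: matrix_vector_mult_def sum_option_UNIV B_def y_def transpose_def
            point_matrix_def add_ones_row_def)
      also have "(\<Sum>l\<in>UNIV. b (s k) $ l * u $ l) = b (s k) \<bullet> u"
        by (simp add: inner_vec_def)
      also have "\<dots> = m"
        using s by blast
      finally show ?thesis by simp
    qed
    then show ?thesis by (simp add: vec_eq_iff)
  qed
  ultimately have "y = 0"
    unfolding invertible_def using matrix_left_invertible_ker by blast
  then have "u $ l = 0" for l
    unfolding y_def vec_eq_iff by (auto dest: spec[of _ "Some l"])
  with \<open>u \<noteq> 0\<close> show False by (simp add: vec_eq_iff)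
qed

text \<open>\<open>F\<close> extends to \<open>CARD('d) + 1\<close> indices; the square submatrix
  with these columns is invertible and has the restriction of \<open>x\<close> in its
  kernel.\<close>

lemma uniform_affine_independence:
  fixes b :: "'n::finite \<Rightarrow> real^'d::finite"
  assumes unif: "uniform (point_matrix b)"
    and "card F \<le> CARD('d) + 1" "CARD('d) + 1 \<le> CARD('n)"
    and supp: "\<And>j. j \<notin> F \<Longrightarrow> x $ j = 0"
    and ker: "(\<Sum>j\<in>UNIV. x $ j) = 0" "(\<Sum>j\<in>UNIV. x $ j *\<^sub>R b j) = 0"
  shows "x = 0"
proof -
  obtain G where G: "F \<subseteq> G" "card G = CARD('d) + 1"
    using exists_subset_between[of F "CARD('d) + 1" UNIV] assms(2,3) by auto
  then obtain s :: "'d option \<Rightarrow> 'n" where "range s \<subseteq> G" and inj: "inj s"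
    using card_le_inj[of "UNIV :: 'd option set" G] by auto
  moreover have "card (range s) = card G"
    using G(2) inj by (simp add: card_image)
  ultimately have ran: "range s = G"
    by (simp add: card_subset_eq)
  define B where "B = (\<chi> i k. point_matrix b $ i $ s k)"
  have "invertible B"
    using unif inj unfolding uniform_def B_def by (simp add: invertible_det_nz)
  moreover have "B *v (\<chi> k. x $ s k) = 0"
  proof -
    have "(B *v (\<chi> k. x $ s k)) $ i = (point_matrix b *v x) $ i" for i
    proof -
      have "(B *v (\<chi> k. x $ s k)) $ i = (\<Sum>j\<in>G. point_matrix b $ i $ j * x $ j)"
        unfolding ran[symmetric] by (simp add: B_def matrix_vector_mult_def sum.reindex[OF inj])
      also have "\<dots> = (\<Sum>j\<in>UNIV. point_matrix b $ i $ j * x $ j)"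
        using supp G(1) by (intro sum.mono_neutral_left) auto
      finally show ?thesis by (simp add: matrix_vector_mult_def)
    qed
    then show ?thesis
      using ker point_matrix_kernel_iff[of b x] by (simp add: vec_eq_iff)
  qed
  ultimately have "(\<chi> k. x $ s k) = 0"
    unfolding invertible_def using matrix_left_invertible_ker by blast
  then have "x $ j = 0" if "j \<in> G" for j
    using that unfolding ran[symmetric] vec_eq_iff by auto
  then show ?thesis
    using supp G(1) unfolding vec_eq_iff by auto
qed

section \<open>Faces of the two configurations\<close>

text \<open>\<open>F\<close> need only lie in the index set of an exposed face, not exhaust it, so
  that \<open>F\<close> can be the support of a weight vector.\<close>

definition on_proper_face :: "('n \<Rightarrow> real^'d) \<Rightarrow> 'n set \<Rightarrow> bool" where
  "on_proper_face b F \<longleftrightarrow> (\<exists>u m. u \<noteq> 0 \<and> (\<forall>j. b j \<bullet> u \<le> m) \<and> (\<forall>j\<in>F. b j \<bullet> u = m))"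

text \<open>The numbers \<open>m - b j \<bullet> u\<close> are the slacks of a supporting
  inequality. Their weighted sum is \<open>0\<close> for an affine dependence, and the slack of the
  weighted point for convex weights.\<close>

lemma sum_weights_gap:
  fixes b :: "'n::finite \<Rightarrow> real^'d"
  shows "(\<Sum>j\<in>UNIV. w $ j * (m - b j \<bullet> u)) = (\<Sum>j\<in>UNIV. w $ j) * m - (\<Sum>j\<in>UNIV. w $ j *\<^sub>R b j) \<bullet> u"
  by (simp add: right_diff_distrib sum_subtractf inner_sum_left sum_distrib_right)

text \<open>Weights are attached to indices rather than to points, so that \<open>b\<close> need not
  be injective.\<close>

lemma in_convex_hull_image:
  fixes b :: "'n::finite \<Rightarrow> real^'d"
  assumes "p \<in> convex hull (b ` I)"
  obtains w :: "real^'n" where "\<forall>j. 0 \<le> w $ j" "\<forall>j. j \<notin> I \<longrightarrow> w $ j = 0"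
    "(\<Sum>j\<in>UNIV. w $ j) = 1" "(\<Sum>j\<in>UNIV. w $ j *\<^sub>R b j) = p"
proof -
  define W where
    "W = {w :: real^'n. (\<forall>j. 0 \<le> w $ j) \<and> (\<forall>j. j \<notin> I \<longrightarrow> w $ j = 0) \<and> (\<Sum>j\<in>UNIV. w $ j) = 1}"
  define f where "f w = (\<Sum>j\<in>UNIV. w $ j *\<^sub>R b j)" for w :: "real^'n"
  have "linear f"
    unfolding f_def
    by (rule linearI) (auto simp: scaleR_add_left sum.distrib scaleR_sum_right)
  moreover have "convex W"
    unfolding W_def convex_def
    by (auto simp: sum.distrib simp flip: sum_distrib_left)
  ultimately have "convex (f ` W)"
    by (rule convex_linear_image)
  moreover have "b j \<in> f ` W" if "j \<in> I" for j
  proof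
    show "b j = f (axis j 1)"
      by (simp add: f_def axis_def if_distrib[of "\<lambda>x. x *\<^sub>R _"] cong: if_cong)
    show "axis j 1 \<in> W"
      using that by (auto simp: W_def axis_def)
  qed
  ultimately have "convex hull (b ` I) \<subseteq> f ` W"
    by (intro hull_minimal) auto
  with assms that show thesis
    unfolding W_def f_def by blast
qed

text \<open>A convex combination equal to a point on a supporting hyperplane uses only points of
  that hyperplane. These are affinely independent, so the combination is trivial.\<close>

lemma supporting_indices_subset:
  fixes b :: "'n::finite \<Rightarrow> real^'d::finite"
  assumes unif: "uniform (point_matrix b)" and "CARD('d) + 1 \<le> CARD('n)"
    and hull: "range b \<subseteq> convex hull (b ` I)"
    and u: "u \<noteq> 0" "\<And>j. b j \<bullet> u \<le> m" and "b j \<bullet> u = m"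
  shows "j \<in> I"
proof (rule ccontr)
  assume "j \<notin> I"
  obtain w :: "real^'n" where w: "\<forall>i. 0 \<le> w $ i" "\<forall>i. i \<notin> I \<longrightarrow> w $ i = 0"
    "(\<Sum>i\<in>UNIV. w $ i) = 1" "(\<Sum>i\<in>UNIV. w $ i *\<^sub>R b i) = b j"
    using in_convex_hull_image[of "b j" b I] hull by blast
  have "(\<Sum>i\<in>UNIV. w $ i * (m - b i \<bullet> u)) = 0"
    unfolding sum_weights_gap using w(3,4) assms(6) by simp
  then have "\<forall>i. w $ i * (m - b i \<bullet> u) = 0"
    using w(1) u(2) by (subst (asm) sum_nonneg_eq_0_iff) auto
  then have supp: "w $ i = 0" if "b i \<bullet> u \<noteq> m" for i
    using that by auto
  have "w - axis j 1 = 0"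
  proof (rule uniform_affine_independence[OF unif _ assms(2)])
    show "card {i. b i \<bullet> u = m} \<le> CARD('d) + 1"
      using uniform_hyperplane_card[OF unif u(1), of m] by simp
    show "(w - axis j 1) $ i = 0" if "i \<notin> {i. b i \<bullet> u = m}" for i
      using that supp assms(6) by (auto simp: axis_def)
    show "(\<Sum>i\<in>UNIV. (w - axis j 1) $ i) = 0"
      using w(3) by (simp add: sum_subtractf axis_def)
    show "(\<Sum>i\<in>UNIV. (w - axis j 1) $ i *\<^sub>R b i) = 0"
      using w(4)
      by (simp add: scaleR_left_diff_distrib sum_subtractf axis_def if_distrib[of "\<lambda>x. x *\<^sub>R _"] cong: if_cong)
  qed
  then have "w $ j = 1" by (simp add: axis_def)
  with w(2) \<open>j \<notin> I\<close> show False by simp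
qed

text \<open>The slacks of a face of \<open>a\<close> are positive on \<open>T\<close> and orthogonal
  to the kernel, so each column of \<open>N\<close>, hence of \<open>N'\<close>, is zero or of mixed
  sign on \<open>T\<close>. As \<open>N'\<close> is dominating, a kernel vector for \<open>b\<close>
  that is nonnegative on \<open>T\<close> vanishes there, and Stiemke's lemma yields the slacks of a
  face of \<open>b\<close>.\<close>

lemma on_proper_face_transfer:
  fixes a b :: "'n::finite \<Rightarrow> real^'d::finite"
  assumes n: "CARD('d) + 1 \<le> CARD('n)"
    and unif: "uniform (point_matrix a)"
    and gale: "gale_dual_on I (point_matrix a) N" "gale_dual_on I (point_matrix b) N'"
    and dom: "dominating I (gale_cols I (point_matrix b)) N'"
    and sgn: "same_sign_pattern I (gale_cols I (point_matrix b)) N N'"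
    and hull_a: "range a \<subseteq> convex hull (a ` I)" and hull_b: "range b \<subseteq> convex hull (b ` I)"
    and F: "F \<noteq> {}" "on_proper_face a F"
  shows "on_proper_face b F"
proof -
  define S where "S = gale_cols I (point_matrix b)"
  have S: "gale_cols I (point_matrix a) = S" "finite S"
    by (auto simp: gale_cols_def S_def)
  obtain u m where u: "u \<noteq> 0" "\<And>j. a j \<bullet> u \<le> m" and Fm: "\<And>j. j \<in> F \<Longrightarrow> a j \<bullet> u = m"
    using F(2) unfolding on_proper_face_def by blast
  define G where "G = {j. a j \<bullet> u = m}"
  define T where "T = I - G"
  have "F \<subseteq> G"
    using Fm unfolding G_def by blast
  have "G \<subseteq> I"
    using supporting_indices_subset[OF unif n hull_a u] unfolding G_def by blast
  \<comment> \<open>Full row rank puts at least \<open>CARD('d) + 1\<close> indices in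
    \<open>I\<close>, more than a hyperplane can hold.\<close>
  have "T \<noteq> {}"
  proof
    assume "T = {}"
    then have "card I \<le> CARD('d)"
      using uniform_hyperplane_card[OF unif u(1), of m] \<open>G \<subseteq> I\<close>
      unfolding T_def G_def by (metis Diff_eq_empty_iff subset_antisym)
    moreover have "CARD('d option) = dim ((\<lambda>j. column j (point_matrix a)) ` I)"
      using gale(1) unfolding gale_dual_on_def by simp
    moreover have "\<dots> \<le> card I"
      by (meson card_image_le dim_le_card' finite finite_imageI le_trans)
    ultimately show False by simp
  qed
  have cols: "(\<forall>i\<in>T. N' i k = 0) \<or> ((\<exists>i\<in>T. N' i k > 0) \<and> (\<exists>i\<in>T. N' i k < 0))"
    if "k \<in> S" for k
  proof -
    define x where "x = column_on I N k"
    have "x \<in> kernel_on I (point_matrix a)"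
      using gale(1) that S(1) unfolding gale_dual_on_def x_def by (metis imageI span_base)
    then have x: "(\<Sum>j\<in>UNIV. x $ j) = 0" "(\<Sum>j\<in>UNIV. x $ j *\<^sub>R a j) = 0"
      unfolding kernel_on_def point_matrix_kernel_iff by auto
    \<comment> \<open>Nothing is lost outside \<open>T\<close>: \<open>x\<close> vanishes outside
      \<open>I\<close> and the slack vanishes on \<open>G\<close>.\<close>
    have "(\<Sum>j\<in>T. N j k * (m - a j \<bullet> u)) = (\<Sum>j\<in>UNIV. x $ j * (m - a j \<bullet> u))"
      by (intro sum.mono_neutral_cong_left) (auto simp: x_def column_on_def T_def G_def)
    also have "\<dots> = 0"
      unfolding sum_weights_gap using x by simp
    finally have sum0: "(\<Sum>j\<in>T. N j k * (m - a j \<bullet> u)) = 0" .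
    have pos: "m - a j \<bullet> u > 0" if "j \<in> T" for j
      using u(2)[of j] that unfolding T_def G_def by auto
    have sgn_eq: "sgn (N j k) = sgn (N' j k)" if "j \<in> T" for j
      using sgn that \<open>k \<in> S\<close> unfolding same_sign_pattern_def T_def S_def by blast
    show ?thesis
    proof (cases "\<forall>j\<in>T. N j k = 0")
      case True
      then show ?thesis
        using sgn_eq by (metis sgn_0_0)
    next
      case False
      then obtain j where j: "j \<in> T" "N j k \<noteq> 0" by blast
      have "(\<exists>i\<in>T. N i k > 0) \<and> (\<exists>i\<in>T. N i k < 0)"
      proof (cases "N j k < 0")
        case True
        then have "N j k * (m - a j \<bullet> u) < 0"
          using pos j by (simp add: mult_neg_pos)
        then obtain l where "l \<in> T" "N l k * (m - a l \<bullet> u) > 0"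
          using exists_pos_summand[of T "\<lambda>j. N j k * (m - a j \<bullet> u)" j] sum0 j(1)
          by (metis finite order_refl)
        then have "N l k > 0"
          using pos[of l] by (simp add: zero_less_mult_iff)
        then show ?thesis
          using True j \<open>l \<in> T\<close> by blast
      next
        case False
        then have "- N j k * (m - a j \<bullet> u) < 0"
          using pos j by (simp add: mult_neg_pos)
        moreover have "(\<Sum>j\<in>T. - N j k * (m - a j \<bullet> u)) = 0"
          using sum0 by (simp add: sum_negf)
        ultimately obtain l where "l \<in> T" "- N l k * (m - a l \<bullet> u) > 0"
          using exists_pos_summand[of T "\<lambda>j. - N j k * (m - a j \<bullet> u)" j] j(1)
          by (metis finite order_refl)
        then have "N l k < 0"
          using pos[of l] by (simp add: mult_less_0_iff)
        moreover have "N j k > 0"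
          using False j(2) by simp
        ultimately show ?thesis
          using j(1) \<open>l \<in> T\<close> by blast
      qed
      then show ?thesis
        using sgn_eq by (metis sgn_greater sgn_less)
    qed
  qed
  have none: "\<forall>i\<in>T. x $ i = 0"
    if x: "x \<in> kernel_on I (point_matrix b)" "\<forall>i\<in>T. x $ i \<ge> 0" for x
  proof -
    have inj: "inj_on (column_on I N') S"
      using gale(2) unfolding gale_dual_on_def S_def by blast
    have "x \<in> span (column_on I N' ` S)"
      using gale(2) x unfolding gale_dual_on_def S_def by blast
    then obtain c where "x = (\<Sum>v\<in>column_on I N' ` S. c v *\<^sub>R v)"
      using span_finite[of "column_on I N' ` S"] S(2) by auto
    then have "x = (\<Sum>k\<in>S. c (column_on I N' k) *\<^sub>R column_on I N' k)"
      by (simp add: sum.reindex[OF inj])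
    then have xi: "x $ i = (\<Sum>k\<in>S. N' i k * c (column_on I N' k))" if "i \<in> T" for i
      using that by (simp add: column_on_def T_def mult.commute)
    show ?thesis
    proof
      fix i assume "i \<in> T"
      have "(\<Sum>k\<in>S. N' i k * c (column_on I N' k)) = 0"
        by (rule dominating_no_semipositive_combination[of I S N' T])
          (use dom x cols S(2) xi \<open>i \<in> T\<close> in \<open>auto simp: S_def T_def\<close>)
      with xi \<open>i \<in> T\<close> show "x $ i = 0" by simp
    qed
  qed
  have "subspace (kernel_on I (point_matrix b))"
    using gale(2) unfolding gale_dual_on_def by (metis subspace_span)
  with none obtain p where p: "\<forall>i\<in>T. p $ i > 0" "\<forall>i. i \<notin> T \<longrightarrow> p $ i = 0"
    "\<forall>x\<in>kernel_on I (point_matrix b). p \<bullet> x = 0"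
    using positive_functional_exists[of "kernel_on I (point_matrix b)" T] by metis
  then obtain c where c: "\<forall>i\<in>I. p $ i = c \<bullet> column i (point_matrix b)"
    using row_combination_of_orthogonal_kernel_on by blast
  \<comment> \<open>The sign makes \<open>p\<close> the vector of slacks of the inequality
    \<open>b i \<bullet> v \<le> c $ None\<close>.\<close>
  define v where "v = - (\<chi> l. c $ Some l)"
  have pv: "p $ i = c $ None - b i \<bullet> v" if "i \<in> I" for i
    using c that by (simp add: point_matrix_column_inner v_def inner_commute)
  have "b i \<bullet> v \<le> c $ None" if "i \<in> I" for i
    using pv[OF that] p by (cases "i \<in> T") force+
  then have "b ` I \<subseteq> {x. v \<bullet> x \<le> c $ None}"
    by (auto simp: inner_commute)
  \<comment> \<open>The hull carries the inequality from the indices in \<open>I\<close> to all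
    indices.\<close>
  then have "convex hull (b ` I) \<subseteq> {x. v \<bullet> x \<le> c $ None}"
    by (simp add: hull_minimal convex_halfspace_le)
  then have "range b \<subseteq> {x. v \<bullet> x \<le> c $ None}"
    using hull_b by (rule order_trans[rotated])
  then have "\<forall>j. b j \<bullet> v \<le> c $ None"
    by (simp add: image_subset_iff inner_commute)
  moreover have G: "b j \<bullet> v = c $ None" if "j \<in> G" for j
  proof -
    have "j \<in> I" "j \<notin> T"
      using that \<open>G \<subseteq> I\<close> unfolding T_def by auto
    then show ?thesis using p pv by force
  qed
  \<comment> \<open>For \<open>v = 0\<close> the slack would be constant on \<open>I\<close>, hence
    zero as on \<open>G\<close>, against its positivity on \<open>T\<close>.\<close>
  moreover have "v \<noteq> 0"
  proof
    assume "v = 0"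
    moreover obtain j where "j \<in> G"
      using F(1) \<open>F \<subseteq> G\<close> by blast
    ultimately have "c $ None = 0"
      using G by force
    with \<open>v = 0\<close> have "p $ i = 0" if "i \<in> I" for i
      using pv that by simp
    with p(1) \<open>T \<noteq> {}\<close> show False
      unfolding T_def by force
  qed
  ultimately show ?thesis
    using \<open>F \<subseteq> G\<close> unfolding on_proper_face_def by blast
qed

section \<open>Weights\<close>

definition prob_weights :: "(real^'n) set" where
  "prob_weights = {w. (\<forall>j. 0 \<le> w $ j) \<and> (\<Sum>j\<in>UNIV. w $ j) = 1}"

definition weighted :: "('n \<Rightarrow> real^'d) \<Rightarrow> real^'n \<Rightarrow> real^'d" where
  "weighted b w = (\<Sum>j\<in>UNIV. w $ j *\<^sub>R b j)"

lemma weighted_gap: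
  fixes b :: "'n::finite \<Rightarrow> real^'d"
  assumes "w \<in> prob_weights"
  shows "(\<Sum>j\<in>UNIV. w $ j * (m - b j \<bullet> u)) = m - weighted b w \<bullet> u"
  using assms unfolding sum_weights_gap by (simp add: prob_weights_def weighted_def)

lemma weighted_inner_eq_max_iff:
  fixes b :: "'n::finite \<Rightarrow> real^'d"
  assumes "w \<in> prob_weights" and "\<And>j. b j \<bullet> u \<le> m"
  shows "weighted b w \<bullet> u = m \<longleftrightarrow> (\<forall>j\<in>{j. w $ j \<noteq> 0}. b j \<bullet> u = m)"
proof -
  have "weighted b w \<bullet> u = m \<longleftrightarrow> (\<Sum>j\<in>UNIV. w $ j * (m - b j \<bullet> u)) = 0"
    using weighted_gap[OF assms(1), of m b u] by auto
  also have "\<dots> \<longleftrightarrow> (\<forall>j. w $ j * (m - b j \<bullet> u) = 0)"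
    using assms by (subst sum_nonneg_eq_0_iff) (auto simp: prob_weights_def)
  finally show ?thesis by auto
qed

lemma continuous_on_weighted [continuous_intros]:
  "continuous_on S f \<Longrightarrow> continuous_on S (\<lambda>x. weighted b (f x))"
  unfolding weighted_def by (intro continuous_intros)

lemma tendsto_weighted [tendsto_intros]:
  "(f \<longlongrightarrow> w) F \<Longrightarrow> ((\<lambda>x. weighted b (f x)) \<longlongrightarrow> weighted b w) F"
  unfolding weighted_def by (intro tendsto_intros)

lemma compact_prob_weights: "compact (prob_weights :: (real^'n::finite) set)"
proof -
  have "closed {w :: real^'n. (\<forall>j. 0 \<le> w $ j) \<and> (\<Sum>j\<in>UNIV. w $ j) = 1}"
    by (intro closed_Collect_conj closed_Collect_all closed_Collect_le closed_Collect_eq continuous_intros)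
  moreover have "norm w \<le> 1" if "w \<in> prob_weights" for w :: "real^'n"
    using that norm_le_l1_cart[of w] by (simp add: prob_weights_def)
  ultimately show ?thesis
    unfolding compact_eq_bounded_closed by (auto simp: bounded_iff prob_weights_def)
qed

lemma weighted_image_prob_weights:
  fixes b :: "'n::finite \<Rightarrow> real^'d"
  shows "weighted b ` prob_weights = convex hull (range b)"
proof
  show "weighted b ` prob_weights \<subseteq> convex hull (range b)"
  proof (rule image_subsetI)
    fix w :: "real^'n" assume "w \<in> prob_weights"
    then show "weighted b w \<in> convex hull (range b)"
      unfolding weighted_def prob_weights_def
      by (intro convex_sum convex_convex_hull) (auto intro: hull_inc)
  qed
  show "convex hull (range b) \<subseteq> weighted b ` prob_weights"
  proof
    fix p assume "p \<in> convex hull (range b)"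
    then show "p \<in> weighted b ` prob_weights"
      by (rule in_convex_hull_image) (auto simp: weighted_def prob_weights_def)
  qed
qed

section \<open>The frontier of the convex hull and its faces\<close>

lemma supporting_functional_of_not_interior:
  fixes S :: "'a::euclidean_space set"
  assumes "convex S" "interior S \<noteq> {}" "p \<notin> interior S"
  obtains v where "v \<noteq> 0" "\<forall>x\<in>S. v \<bullet> p \<le> v \<bullet> x"
proof -
  obtain v b where v: "v \<noteq> 0" "v \<bullet> p \<le> b" "\<forall>x\<in>interior S. b \<le> v \<bullet> x"
    using separating_hyperplane_sets[of "{p}" "interior S"] assms convex_interior by auto
  \<comment> \<open>\<open>S\<close> lies in the closure of its interior, so the weak inequality
    extends to all of \<open>S\<close>.\<close>
  have "closure (interior S) \<subseteq> {x. b \<le> v \<bullet> x}"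
    by (rule closure_minimal) (use v closed_halfspace_ge in auto)
  then have "S \<subseteq> {x. b \<le> v \<bullet> x}"
    using convex_closure_interior[OF assms(1,2)] closure_subset by blast
  with v that[of v] show thesis by force
qed

text \<open>A functional supporting the hull at \<open>weighted b w\<close> is extremal at every
  point of nonzero weight. Lying on the frontier thus depends only on the support of
  \<open>w\<close>, which allows a comparison of two configurations.\<close>

lemma weighted_in_frontier_iff:
  fixes b :: "'n::finite \<Rightarrow> real^'d::finite"
  assumes w: "w \<in> prob_weights" and int: "interior (convex hull (range b)) \<noteq> {}"
  shows "weighted b w \<in> frontier (convex hull (range b)) \<longleftrightarrow> on_proper_face b {j. w $ j \<noteq> 0}"
proof -
  define H where "H = convex hull (range b)"
  have "compact H"
    unfolding H_def by (simp add: finite_imp_compact_convex_hull)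
  have H: "weighted b w \<in> H"
    using w weighted_image_prob_weights unfolding H_def by blast
  have fr: "weighted b w \<in> frontier H \<longleftrightarrow> weighted b w \<notin> interior H"
    using H \<open>compact H\<close> unfolding frontier_def by (simp add: compact_imp_closed)
  have "on_proper_face b {j. w $ j \<noteq> 0}" if notin: "weighted b w \<notin> interior H"
  proof -
    obtain v where v: "v \<noteq> 0" "\<forall>x\<in>H. v \<bullet> weighted b w \<le> v \<bullet> x"
      using convex_convex_hull[of "range b"] int notin unfolding H_def[symmetric]
      by (rule supporting_functional_of_not_interior)
    then have le: "b j \<bullet> (- v) \<le> weighted b w \<bullet> (- v)" for j
      using hull_inc[of "b j" "range b" convex] unfolding H_def by (auto simp: inner_commute)
    from weighted_inner_eq_max_iff[OF w this]
    have "\<forall>j\<in>{j. w $ j \<noteq> 0}. b j \<bullet> (- v) = weighted b w \<bullet> (- v)"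
      by (rule iffD1) simp
    with le v(1) show ?thesis
      unfolding on_proper_face_def by (intro exI[of _ "- v"] exI[of _ "weighted b w \<bullet> (- v)"]) simp
  qed
  moreover have "weighted b w \<notin> interior H" if face: "on_proper_face b {j. w $ j \<noteq> 0}"
  proof -
    obtain u m where u: "u \<noteq> 0" "\<And>j. b j \<bullet> u \<le> m" "\<forall>j\<in>{j. w $ j \<noteq> 0}. b j \<bullet> u = m"
      using face unfolding on_proper_face_def by auto
    have "H \<subseteq> {x. u \<bullet> x \<le> m}"
      unfolding H_def using u(2) by (intro hull_minimal convex_halfspace_le) (auto simp: inner_commute)
    then have "interior H \<subseteq> {x. u \<bullet> x < m}"
      using interior_mono interior_halfspace_le[OF u(1)] by blast
    moreover have "weighted b w \<bullet> u = m"
      using weighted_inner_eq_max_iff[of w b u m] w u by blast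
    ultimately show ?thesis
      by (auto simp: inner_commute)
  qed
  ultimately show ?thesis
    using fr unfolding H_def by blast
qed

text \<open>Proper faces are simplices: two weights with the same image are supported on one
  supporting hyperplane, whose points are affinely independent.\<close>

lemma weighted_inj_on_frontier:
  fixes b :: "'n::finite \<Rightarrow> real^'d::finite"
  assumes unif: "uniform (point_matrix b)" and n: "CARD('d) + 1 \<le> CARD('n)"
    and int: "interior (convex hull (range b)) \<noteq> {}"
  shows "inj_on (weighted b) {w \<in> prob_weights. weighted b w \<in> frontier (convex hull (range b))}"
proof (rule inj_onI, clarify)
  fix x y :: "real^'n"
  assume x: "x \<in> prob_weights" "weighted b x \<in> frontier (convex hull (range b))"
    and y: "y \<in> prob_weights" and eq: "weighted b x = weighted b y"
  obtain u m where u: "u \<noteq> 0" "\<And>j. b j \<bullet> u \<le> m" "\<forall>j\<in>{j. x $ j \<noteq> 0}. b j \<bullet> u = m"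
    using weighted_in_frontier_iff[OF x(1) int] x(2) unfolding on_proper_face_def by auto
  then have supp_y: "\<forall>j\<in>{j. y $ j \<noteq> 0}. b j \<bullet> u = m"
    using weighted_inner_eq_max_iff[OF x(1), of b u m] weighted_inner_eq_max_iff[OF y, of b u m] eq by auto
  have "x - y = 0"
  proof (rule uniform_affine_independence[OF unif _ n])
    show "card {j. b j \<bullet> u = m} \<le> CARD('d) + 1"
      using uniform_hyperplane_card[OF unif u(1), of m] by simp
    show "(x - y) $ j = 0" if "j \<notin> {j. b j \<bullet> u = m}" for j
      using that u(3) supp_y
      by (metis (mono_tags, lifting) diff_zero mem_Collect_eq vector_minus_component)
    show "(\<Sum>j\<in>UNIV. (x - y) $ j) = 0"
      using x y by (simp add: prob_weights_def sum_subtractf)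
    show "(\<Sum>j\<in>UNIV. (x - y) $ j *\<^sub>R b j) = 0"
      using eq by (simp add: weighted_def scaleR_left_diff_distrib sum_subtractf)
  qed
  then show "x = y" by simp
qed

text \<open>Otherwise some \<open>v \<noteq> 0\<close> has \<open>b j \<bullet> v \<ge> 0\<close>
  for all \<open>j\<close>; the positive dependence forces equality, and all points lie on one
  hyperplane, against uniformity.\<close>

lemma zero_in_interior_convex_hull:
  fixes b :: "'n::finite \<Rightarrow> real^'d::finite"
  assumes unif: "uniform (point_matrix b)" and n: "CARD('d) + 1 \<le> CARD('n)"
    and pos: "\<And>j. u j > 0" and sum0: "(\<Sum>j\<in>UNIV. u j *\<^sub>R b j) = 0"
  shows "0 \<in> interior (convex hull (range b))"
proof (rule ccontr)
  assume not_int: "\<not> ?thesis"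
  have no_hyperplane: "\<exists>j. b j \<bullet> v \<noteq> m" if "v \<noteq> 0" for v m
  proof (rule ccontr)
    assume "\<not> ?thesis"
    then have "{j. b j \<bullet> v = m} = UNIV" by auto
    then show False
      using uniform_hyperplane_card[OF unif that, of m] n by simp
  qed
  have "interior (convex hull (range b)) \<noteq> {}"
  proof
    assume "interior (convex hull (range b)) = {}"
    then obtain v m where "v \<noteq> 0" "convex hull (range b) \<subseteq> {x. v \<bullet> x = m}"
      using empty_interior_subset_hyperplane[of "convex hull (range b)"] by (metis convex_convex_hull)
    then show False
      using no_hyperplane[of v m] hull_inc[of _ "range b" convex] by (force simp: inner_commute)
  qed
  with not_int obtain v where v: "v \<noteq> 0" "\<forall>x\<in>convex hull (range b). v \<bullet> 0 \<le> v \<bullet> x"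
    using supporting_functional_of_not_interior[of "convex hull (range b)" 0] by auto
  then have "0 \<le> b j \<bullet> v" for j
    using hull_inc[of "b j" "range b" convex] by (auto simp: inner_commute)
  moreover have "(\<Sum>j\<in>UNIV. u j * (b j \<bullet> v)) = 0"
  proof -
    have "(\<Sum>j\<in>UNIV. u j * (b j \<bullet> v)) = (\<Sum>j\<in>UNIV. u j *\<^sub>R b j) \<bullet> v"
      by (simp add: inner_sum_left)
    with sum0 show ?thesis by simp
  qed
  ultimately have "\<forall>j. u j * (b j \<bullet> v) = 0"
    using pos by (subst (asm) sum_nonneg_eq_0_iff) (auto simp: less_imp_le)
  then have "b j \<bullet> v = 0" for j
    using pos[of j] by (metis less_irrefl mult_eq_0_iff)
  with no_hyperplane[OF v(1)] show False by blast
qed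

section \<open>Zeros of exponential sums\<close>

text \<open>Without a zero, the retraction to the frontier applies to every mean
  \<open>weighted c (W t)\<close>; the barycentric coordinates \<open>L t\<close> of the result are,
  by \<open>faces\<close>, also weights on a proper face of \<open>a\<close>.\<close>

lemma exponential_sum_zero_exists:
  fixes a c :: "'n::finite \<Rightarrow> real^'d::finite"
  assumes n: "CARD('d) + 1 \<le> CARD('n)"
    and unif_a: "uniform (point_matrix a)" and unif_c: "uniform (point_matrix c)"
    and faces: "\<And>F. F \<noteq> {} \<Longrightarrow> on_proper_face a F \<longleftrightarrow> on_proper_face c F"
    and zero_int: "0 \<in> interior (convex hull (range c))"
  obtains t where "(\<Sum>j\<in>UNIV. exp (a j \<bullet> t) *\<^sub>R c j) = 0"
proof (rule ccontr)
  assume "\<not> thesis"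
  with that have no_zero: "(\<Sum>j\<in>UNIV. exp (a j \<bullet> t) *\<^sub>R c j) \<noteq> 0" for t
    by blast
  define H where "H = convex hull (range c)"
  define K where "K = {w \<in> prob_weights. weighted c w \<in> frontier H}"
  define p0 where "p0 = (1 / real CARD('n)) *\<^sub>R (\<Sum>j\<in>UNIV. a j)"
  define V where "V w = weighted a w - p0" for w
  \<comment> \<open>Dividing by \<open>Z t\<close> turns the exponentials into probability weights
    \<open>W t\<close> and only rescales the sum.\<close>
  define Z where "Z t = (\<Sum>j\<in>UNIV. exp (a j \<bullet> t))" for t
  define W where "W t = (\<chi> j. exp (a j \<bullet> t) / Z t)" for t
  have int: "interior (convex hull (range c)) \<noteq> {}"
    using zero_int by auto
  \<comment> \<open>The centroid lies strictly below a supporting hyperplane, since not all points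
    are on it; so \<open>V w\<close> has a positive component along the outer normal.\<close>
  have V_pos: "V w \<bullet> u > 0"
    if w: "w \<in> prob_weights" and u: "u \<noteq> 0" "\<And>j. a j \<bullet> u \<le> m" "\<forall>j\<in>{j. w $ j \<noteq> 0}. a j \<bullet> u = m" for w u m
  proof -
    have "(\<Sum>j\<in>UNIV. a j \<bullet> u) < (\<Sum>j\<in>(UNIV::'n set). m)"
    proof (rule sum_strict_mono_ex1)
      have "{j. a j \<bullet> u = m} \<noteq> UNIV"
        using uniform_hyperplane_card[OF unif_a u(1), of m] n by auto
      then show "\<exists>j\<in>UNIV. a j \<bullet> u < m"
        using u(2) by (metis (mono_tags, lifting) UNIV_I UNIV_eq_I linorder_neqE_linordered_idom mem_Collect_eq not_less)
    qed (use u in auto)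
    then have "p0 \<bullet> u < m"
      by (simp add: p0_def inner_sum_left field_simps)
    moreover have "weighted a w \<bullet> u = m"
      using weighted_inner_eq_max_iff[of w a u m] w u by blast
    ultimately show ?thesis
      by (simp add: V_def inner_diff_left)
  qed
  have supp_nonempty: "{j. w $ j \<noteq> 0} \<noteq> {}" if "w \<in> prob_weights" for w :: "real^'n"
  proof
    assume "{j. w $ j \<noteq> 0} = {}"
    then have "(\<Sum>j\<in>UNIV. w $ j) = 0"
      by (intro sum.neutral) auto
    with that show False by (simp add: prob_weights_def)
  qed
  \<comment> \<open>Here the two configurations are linked: \<open>K\<close>, defined through
    \<open>c\<close>, is described by the faces of \<open>a\<close>.\<close>
  have K_iff: "w \<in> K \<longleftrightarrow> on_proper_face a {j. w $ j \<noteq> 0}" if "w \<in> prob_weights" for w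
    using that weighted_in_frontier_iff[OF that int] faces[OF supp_nonempty[OF that]]
    unfolding K_def H_def by auto
  have V_nonzero: "V w \<noteq> 0" if "w \<in> K" for w
  proof -
    have w: "w \<in> prob_weights" using that unfolding K_def by blast
    then have "on_proper_face a {j. w $ j \<noteq> 0}"
      using K_iff that by blast
    then obtain u m where u: "u \<noteq> 0" "\<And>j. a j \<bullet> u \<le> m" "\<forall>j\<in>{j. w $ j \<noteq> 0}. a j \<bullet> u = m"
      unfolding on_proper_face_def by blast
    have "V w \<bullet> u > 0"
      using w u by (rule V_pos)
    then show ?thesis by auto
  qed
  have "compact H" "convex H"
    unfolding H_def by (simp_all add: finite_imp_compact_convex_hull)
  have K_eq: "K = prob_weights \<inter> weighted c -` frontier H"
    unfolding K_def by auto
  have "compact K"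
    unfolding K_eq
    by (intro compact_Int_closed compact_prob_weights closed_vimage frontier_closed continuous_intros)
  have "weighted c ` K = frontier H"
  proof -
    have "frontier H \<subseteq> weighted c ` prob_weights"
      using \<open>compact H\<close> weighted_image_prob_weights[of c] frontier_subset_compact unfolding H_def by blast
    then show ?thesis
      unfolding K_eq by auto
  qed
  moreover have "inj_on (weighted c) K"
    unfolding K_def H_def using unif_c n int by (rule weighted_inj_on_frontier)
  moreover have "continuous_on K (weighted c)"
    by (intro continuous_intros)
  \<comment> \<open>A continuous bijection from a compact set is a homeomorphism; \<open>g\<close>
    gives the barycentric coordinates of a frontier point.\<close>
  ultimately obtain g where g: "homeomorphism K (frontier H) (weighted c) g"
    using homeomorphism_compact[OF \<open>compact K\<close>] by blast
  have "frontier H retract_of - {0}"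
    using frontier_retract_of_punctured_universe[OF \<open>convex H\<close>] \<open>compact H\<close> zero_int
    unfolding H_def by (simp add: compact_imp_bounded)
  then obtain r where r: "continuous_on (- {0}) r" "r \<in> - {0} \<rightarrow> frontier H" "\<forall>x\<in>frontier H. r x = x"
    unfolding retract_of_def retraction_def by blast
  have Z_pos: "Z t > 0" for t
    unfolding Z_def by (intro sum_pos) auto
  have W: "W t \<in> prob_weights" for t
    using Z_pos[of t] unfolding prob_weights_def W_def
    by (auto simp: Z_def less_imp_le simp flip: sum_divide_distrib)
  have WF: "weighted c (W t) \<noteq> 0" for t
  proof -
    have "weighted c (W t) = (1 / Z t) *\<^sub>R (\<Sum>j\<in>UNIV. exp (a j \<bullet> t) *\<^sub>R c j)"
      by (simp add: weighted_def W_def scaleR_sum_right)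
    with no_zero[of t] Z_pos[of t] show ?thesis by simp
  qed
  have cont_W: "continuous_on UNIV W"
  proof -
    have "continuous_on UNIV Z"
      unfolding Z_def by (intro continuous_intros)
    moreover have "\<forall>t\<in>UNIV. Z t \<noteq> 0"
      using Z_pos by (simp add: less_imp_neq[symmetric])
    ultimately show ?thesis
      unfolding W_def by (intro continuous_on_vec_lambda continuous_on_divide continuous_intros)
  qed
  define L where "L t = g (r (weighted c (W t)))" for t
  have L: "L t \<in> K" for t
    using g r(2) WF[of t] unfolding L_def homeomorphism_def by blast
  have cont_L: "continuous_on UNIV L"
    unfolding L_def
  proof (rule continuous_on_compose2[OF homeomorphism_cont2[OF g]])
    show "continuous_on UNIV (\<lambda>t. r (weighted c (W t)))"
      by (rule continuous_on_compose2[OF r(1) continuous_on_weighted[OF cont_W]]) (use WF in auto)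
    show "range (\<lambda>t. r (weighted c (W t))) \<subseteq> frontier H"
      using r(2) WF by blast
  qed
  have cont_V: "continuous_on S V" for S
    unfolding V_def by (intro continuous_intros)
  have cont_VL: "continuous_on UNIV (\<lambda>t. V (L t))"
    by (rule continuous_on_compose2[OF cont_V[of UNIV] cont_L]) simp
  \<comment> \<open>The bound on \<open>V\<close> over \<open>K\<close> makes the map
    \<open>- k V (L t)\<close> send the ball of radius \<open>k * B\<close> into itself.\<close>
  have "bounded (V ` K)"
    using \<open>compact K\<close> cont_V by (intro compact_imp_bounded compact_continuous_image)
  then obtain B where B: "\<And>w. w \<in> K \<Longrightarrow> norm (V w) \<le> B"
    unfolding bounded_iff by blast
  have "\<forall>k. \<exists>t. t = - (real k *\<^sub>R V (L t))"
  proof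
    fix k
    have "B \<ge> 0"
      by (rule order_trans[OF norm_ge_zero B[OF L]])
    obtain t where "- (real k *\<^sub>R V (L t)) = t"
    proof (rule brouwer[of "cball 0 (real k * B)" "\<lambda>t. - (real k *\<^sub>R V (L t))"])
      show "continuous_on (cball 0 (real k * B)) (\<lambda>t. - (real k *\<^sub>R V (L t)))"
        by (intro continuous_intros continuous_on_subset[OF cont_VL] subset_UNIV)
      show "(\<lambda>t. - (real k *\<^sub>R V (L t))) \<in> cball 0 (real k * B) \<rightarrow> cball 0 (real k * B)"
        using B[OF L] by (auto intro!: mult_left_mono)
    qed (use \<open>B \<ge> 0\<close> in \<open>auto simp: not_less\<close>)
    then show "\<exists>t. t = - (real k *\<^sub>R V (L t))" by (intro exI[of _ t]) simp
  qed
  then obtain t where t: "\<And>k. t k = - (real k *\<^sub>R V (L (t k)))"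
    using choice[of "\<lambda>k t. t = - (real k *\<^sub>R V (L t))"] by blast

  \<comment> \<open>The limit of the fixed points along a subsequence\<close>
  have comp: "compact (prob_weights \<times> K)"
    using compact_prob_weights \<open>compact K\<close> by (rule compact_Times)
  have in_comp: "\<forall>k. (W (t k), L (t k)) \<in> prob_weights \<times> K"
    using W L by blast
  obtain l s where l: "l \<in> prob_weights \<times> K" and s: "strict_mono s"
    and lim: "((\<lambda>k. (W (t k), L (t k))) \<circ> s) \<longlonglongrightarrow> l"
    using comp[unfolded compact_def, THEN spec, THEN mp, OF in_comp] by blast
  obtain w y where wy: "l = (w, y)" by (cases l)
  have w: "w \<in> prob_weights" and y: "y \<in> K"
    using l wy by auto
  have lim_W: "(\<lambda>k. W (t (s k))) \<longlonglongrightarrow> w"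
    using tendsto_fst[OF lim] by (simp add: wy o_def)
  have lim_L: "(\<lambda>k. L (t (s k))) \<longlonglongrightarrow> y"
    using tendsto_snd[OF lim] by (simp add: wy o_def)
  \<comment> \<open>By the fixed point equation, \<open>u\<close> is the limit of
    \<open>t (s k) / s k\<close>.\<close>
  define u where "u = - V y"
  have "u \<noteq> 0"
    using V_nonzero[OF y] unfolding u_def by simp
  define m where "m = Max (range (\<lambda>j. a j \<bullet> u))"
  have le_m: "a j \<bullet> u \<le> m" for j
    unfolding m_def by simp
  have "m \<in> range (\<lambda>j. a j \<bullet> u)"
    unfolding m_def by (rule Max_in) auto
  then obtain k0 where k0: "a k0 \<bullet> u = m"
    by (elim imageE) simp
  have supp_w: "w $ j = 0" if j: "a j \<bullet> u \<noteq> m" for j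
  proof -
    \<comment> \<open>\<open>- e k * s k\<close> is the difference of the exponents of
      \<open>j\<close> and the maximiser \<open>k0\<close>; as \<open>e\<close> has a positive
      limit, the weight of \<open>j\<close> decays to \<open>0\<close>.\<close>
    define e where "e k = (a j - a k0) \<bullet> V (L (t (s k)))" for k
    have "e \<longlonglongrightarrow> (a j - a k0) \<bullet> V y"
      unfolding e_def V_def by (intro tendsto_intros lim_L)
    moreover have "(a j - a k0) \<bullet> V y > 0"
      using le_m[of j] j k0 unfolding u_def by (simp add: inner_diff_left)
    moreover have "filterlim (\<lambda>k. real (s k)) at_top sequentially"
      by (rule filterlim_compose[OF filterlim_real_sequentially filterlim_subseq[OF s]])
    ultimately have "filterlim (\<lambda>k. e k * real (s k)) at_top sequentially"
      by (rule filterlim_tendsto_pos_mult_at_top)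
    then have "filterlim (\<lambda>k. - (e k * real (s k))) at_bot sequentially"
      by (simp add: filterlim_uminus_at_bot)
    then have lim0: "(\<lambda>k. exp (- (e k * real (s k)))) \<longlonglongrightarrow> 0"
      by (rule filterlim_compose[OF exp_at_bot])
    have "W (t (s k)) $ j \<le> exp (- (e k * real (s k)))" for k
    proof -
      let ?t = "t (s k)"
      have "exp (a k0 \<bullet> ?t) \<le> Z ?t"
        unfolding Z_def by (rule member_le_sum) auto
      then have "W ?t $ j \<le> exp (a j \<bullet> ?t) / exp (a k0 \<bullet> ?t)"
        unfolding W_def by (simp add: frac_le)
      also have "\<dots> = exp ((a j - a k0) \<bullet> ?t)"
        by (simp add: exp_diff inner_diff_left)
      also have "(a j - a k0) \<bullet> ?t = - (e k * real (s k))"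
        by (subst t) (simp add: e_def)
      finally show ?thesis .
    qed
    moreover have "0 \<le> W (t (s k)) $ j" for k
      using W[of "t (s k)"] unfolding prob_weights_def by blast
    ultimately have "(\<lambda>k. W (t (s k)) $ j) \<longlonglongrightarrow> 0"
      by (intro tendsto_sandwich[OF _ _ tendsto_const lim0]) auto
    moreover have "(\<lambda>k. W (t (s k)) $ j) \<longlonglongrightarrow> w $ j"
      using lim_W by (rule tendsto_vec_nth)
    ultimately show ?thesis
      using LIMSEQ_unique by blast
  qed
  then have "w \<in> K"
    unfolding K_iff[OF w] on_proper_face_def
    using le_m \<open>u \<noteq> 0\<close> by (intro exI[of _ u] exI[of _ m]) auto
  then have w_fr: "weighted c w \<in> frontier H"
    unfolding K_def by blast
  have "weighted c w \<noteq> 0"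
    using w_fr zero_int unfolding H_def frontier_def by auto
  \<comment> \<open>The image of \<open>w\<close> is on the frontier, where \<open>r\<close> is the
    identity and \<open>g\<close> inverts \<open>weighted c\<close>. Hence \<open>L\<close> has the
    same limit as \<open>W\<close>, which gives \<open>y = w\<close>.\<close>
  have lim_r: "(\<lambda>k. r (weighted c (W (t (s k))))) \<longlonglongrightarrow> r (weighted c w)"
    by (rule continuous_on_tendsto_compose[OF r(1) tendsto_weighted[OF lim_W]])
      (use \<open>weighted c w \<noteq> 0\<close> WF in simp_all)
  have "r (weighted c (W (t (s k)))) \<in> frontier H" for k
    using r(2) WF by blast
  then have "(\<lambda>k. L (t (s k))) \<longlonglongrightarrow> g (r (weighted c w))"
    unfolding L_def
    by (intro continuous_on_tendsto_compose[OF homeomorphism_cont2[OF g] lim_r])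
      (use r(3) w_fr in simp_all)
  moreover have "g (r (weighted c w)) = w"
    using r(3) w_fr homeomorphism_apply1[OF g \<open>w \<in> K\<close>] by simp
  ultimately have "y = w"
    using lim_L LIMSEQ_unique by metis
  \<comment> \<open>Now \<open>u = - V w\<close>, although \<open>w\<close> is supported on the face
    maximal in direction \<open>u\<close>.\<close>
  then have "V w \<bullet> u \<le> 0"
    unfolding u_def by simp
  moreover have "V w \<bullet> u > 0"
    using V_pos[OF w \<open>u \<noteq> 0\<close> le_m] supp_w by blast
  ultimately show False by simp
qed

theorem theorem5p8:
  fixes a :: "'n::finite \<Rightarrow> real^'d::finite"
    and C :: "real^'n^'d"
  assumes "CARD('n) \<ge> CARD('d) + 2"
    and "inj a"
    and "uniform (point_matrix a)"
    and "uniform C"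
    and "uniform (add_ones_row C)"
    and "0 \<in> open_column_cone C"
    and "\<exists>I. compatible I a C"
  shows "num_positive_solutions a C > 0"
proof -
  define c where "c j = column j C" for j
  have C: "add_ones_row C = point_matrix c"
    by (simp add: add_ones_row_column c_def[abs_def])
  have n: "CARD('d) + 1 \<le> CARD('n)"
    using assms(1) by simp
  obtain I N N' where gale: "gale_dual_on I (point_matrix a) N" "gale_dual_on I (point_matrix c) N'"
    and dom: "dominating I (gale_cols I (point_matrix a)) N" "dominating I (gale_cols I (point_matrix c)) N'"
    and sgn: "same_sign_pattern I (gale_cols I (point_matrix a)) N N'"
    and hull: "convex hull (a ` I) = convex hull (range a)" "convex hull (c ` I) = convex hull (range c)"
    using assms(7) unfolding compatible_def mixed_dominating_def C c_def[symmetric] by blast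
  have cols: "gale_cols I (point_matrix a) = gale_cols I (point_matrix c)"
    by (simp add: gale_cols_def)
  have hull': "range a \<subseteq> convex hull (a ` I)" "range c \<subseteq> convex hull (c ` I)"
    unfolding hull by (rule hull_subset)+
  have sgn': "same_sign_pattern I (gale_cols I (point_matrix a)) N' N"
    using sgn unfolding same_sign_pattern_def by simp
  have unif_c: "uniform (point_matrix c)"
    using assms(5) C by simp
  \<comment> \<open>Each direction uses the dominating Gale dual of the target
    configuration.\<close>
  have "on_proper_face a F \<longleftrightarrow> on_proper_face c F" if "F \<noteq> {}" for F
    using on_proper_face_transfer[OF n assms(3) gale dom(2) sgn[unfolded cols] hull' that]
      on_proper_face_transfer[OF n unif_c gale(2,1) dom(1) sgn' hull'(2,1) that] by blast
  moreover obtain u where u: "\<And>j. u j > 0" "(\<Sum>j\<in>UNIV. u j *\<^sub>R c j) = 0"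
    using assms(6) unfolding open_column_cone_def c_def by auto
  ultimately obtain t where t: "(\<Sum>j\<in>UNIV. exp (a j \<bullet> t) *\<^sub>R c j) = 0"
    using exponential_sum_zero_exists[OF n assms(3) unif_c]
      zero_in_interior_convex_hull[OF unif_c n u] by blast
  \<comment> \<open>This substitution turns the monomials into the exponentials
    \<open>exp (a j \<bullet> t)\<close>.\<close>
  define x where "x = (\<chi> l. exp (t $ l))"
  have mon: "monomial_at x (a j) = exp (a j \<bullet> t)" for j
    by (simp add: monomial_at_def x_def powr_def inner_vec_def exp_sum)
  have "(\<Sum>j\<in>UNIV. C $ i $ j * monomial_at x (a j)) = 0" for i
  proof -
    have "(\<Sum>j\<in>UNIV. C $ i $ j * monomial_at x (a j)) = (\<Sum>j\<in>UNIV. exp (a j \<bullet> t) *\<^sub>R c j) $ i"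
      by (simp add: mon c_def column_def mult.commute)
    with t show ?thesis by simp
  qed
  then have "x \<in> positive_solutions a C"
    by (simp add: positive_solutions_def x_def)
  then show ?thesis
    unfolding num_positive_solutions_def
    by (auto simp: card_gt_0_iff zero_enat_def)
qed

end
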